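(* Let $q\ge 2$ be an integer and $k$ a positive integer, and let $M$ be a matroid with (matroid) tree-width at most $k$ and no minor isomorphic to the uniform matroid $U_{2,2+q}$. Then the characteristic polynomial $\chi_M(\lambda)$ is identically zero or else $\chi_M(\lambda)>0$ for all real $\lambda>\frac{q^k-1}{q-1}$.
   Context: For a loopless matroid $M$ with ground set $E$ and rank function $r$, the characteristic polynomial is $\chi_M(\lambda)=\sum_{F\in L}\mu_M(\emptyset,F)\lambda^{r(E)-r(F)}$, where $L$ is the lattice of flats of $M$ and $\mu_M$ its Möbius function; if $M$ has a loop, $\chi_M(\lambda)$ is defined to be $0$. Matroid tree-width: a tree-decomposition of $M$ is a pair $(T,\tau)$ with $T$ a tree and $\tau:E(M)\to V(T)$ an arbitrary map. For a vertex $v$ of $T$, let $T_1,\dots,T_c$ be the components of $T-v$ and $B_j=\{e\in E(M):\tau(e)\in V(T_j)\}$. The rank defect of a set $B$ is $\mathrm{rd}(B)=r(M)-r(E(M)-B)$. The node width of $v$ is $r(M)-\sum_{j=1}^{c}\mathrm{rd}(B_j)$ (equal to $r(M)$ if $T$ has one vertex). The width of $(T,\tau)$ is the maximum node width over the vertices of $T$, and the tree-width $\mathrm{tw}(M)$ is the minimum width over all tree-decompositions of $M$. *)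

theory Defs
  imports Complex_Main "HOL-Computational_Algebra.Polynomial"
begin

section \<open>Matroids\<close>

record 'a pre_matroid =
  ground :: "'a set"
  indeps :: "'a set set"

locale matroid =
  fixes M :: "'a pre_matroid"
  assumes finite_ground: "finite (ground M)"
    and indeps_subset: "I \<in> indeps M \<Longrightarrow> I \<subseteq> ground M"
    and empty_indep: "{} \<in> indeps M"
    and indep_mono: "I \<in> indeps M \<Longrightarrow> J \<subseteq> I \<Longrightarrow> J \<in> indeps M"
    and augment: "I \<in> indeps M \<Longrightarrow> J \<in> indeps M \<Longrightarrow> card I < card J \<Longrightarrow>
      \<exists>e \<in> J - I. insert e I \<in> indeps M"

definition rk :: "'a pre_matroid \<Rightarrow> 'a set \<Rightarrow> nat" where
  "rk M X = Max (card ` {I \<in> indeps M. I \<subseteq> X})"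

definition is_loop :: "'a pre_matroid \<Rightarrow> 'a \<Rightarrow> bool" where
  "is_loop M e \<longleftrightarrow> e \<in> ground M \<and> {e} \<notin> indeps M"

definition loopless :: "'a pre_matroid \<Rightarrow> bool" where
  "loopless M \<longleftrightarrow> (\<nexists>e. is_loop M e)"

definition flats :: "'a pre_matroid \<Rightarrow> 'a set set" where
  "flats M = {F. F \<subseteq> ground M \<and> (\<forall>e \<in> ground M - F. rk M F < rk M (insert e F))}"


section \<open>Minors, isomorphism and uniform matroids\<close>

definition delete :: "'a pre_matroid \<Rightarrow> 'a set \<Rightarrow> 'a pre_matroid" where
  "delete M D = \<lparr>ground = ground M - D, indeps = {I \<in> indeps M. I \<inter> D = {}}\<rparr>"

text \<open>The matroid \<open>M/C\<close> has rank function \<open>X \<mapsto> r(X \<union> C) - r(C)\<close>, and a set is independent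
  iff its rank equals its cardinality.\<close>

definition contract :: "'a pre_matroid \<Rightarrow> 'a set \<Rightarrow> 'a pre_matroid" where
  "contract M C = \<lparr>ground = ground M - C,
     indeps = {I. I \<subseteq> ground M - C \<and> rk M (I \<union> C) = card I + rk M C}\<rparr>"

definition is_minor :: "'a pre_matroid \<Rightarrow> 'a pre_matroid \<Rightarrow> bool" where
  "is_minor N M \<longleftrightarrow> (\<exists>C D. C \<subseteq> ground M \<and> D \<subseteq> ground M \<and> C \<inter> D = {} \<and>
     N = delete (contract M C) D)"

definition matroid_iso :: "'a pre_matroid \<Rightarrow> 'b pre_matroid \<Rightarrow> bool" where
  "matroid_iso M N \<longleftrightarrow> (\<exists>f. bij_betw f (ground M) (ground N) \<and>
     (\<forall>I \<subseteq> ground M. I \<in> indeps M \<longleftrightarrow> f ` I \<in> indeps N))"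

definition uniform_matroid :: "nat \<Rightarrow> nat \<Rightarrow> nat pre_matroid" where
  "uniform_matroid r n = \<lparr>ground = {..<n}, indeps = {I. I \<subseteq> {..<n} \<and> card I \<le> r}\<rparr>"


section \<open>Moebius function and characteristic polynomial\<close>

text \<open>The Moebius function of the finite poset \<open>P\<close>, with the order of the ambient type.\<close>

function moebius :: "'b::order set \<Rightarrow> 'b \<Rightarrow> 'b \<Rightarrow> int" where
  "moebius P x z =
     (if x = z then 1
      else if finite P \<and> x < z then - (\<Sum>y \<in> {y \<in> P. x \<le> y \<and> y < z}. moebius P x y)
      else 0)"
  by pat_completeness auto
termination
proof (relation "measure (\<lambda>(P, x, z). card {y \<in> P. y < z})")
  fix P :: "'b::order set" and x z y :: 'b
  assume *: "finite P \<and> x < z" "y \<in> {y \<in> P. x \<le> y \<and> y < z}"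
  then have "{w \<in> P. w < y} \<subset> {w \<in> P. w < z}" by force
  with * show "((P, x, y), P, x, z) \<in> measure (\<lambda>(P, x, z). card {y \<in> P. y < z})"
    by (auto intro!: psubset_card_mono)
qed auto

declare moebius.simps [simp del]

definition matroid_charpoly :: "'a pre_matroid \<Rightarrow> real poly" where
  "matroid_charpoly M =
     (if loopless M
      then \<Sum>F \<in> flats M. monom (of_int (moebius (flats M) {} F)) (rk M (ground M) - rk M F)
      else 0)"


section \<open>Trees\<close>

text \<open>A graph is given by its vertex set \<open>V\<close> and its set \<open>E\<close> of two-element edges.
  \<open>walk_rel E S\<close> relates vertices joined by a walk of edges inside \<open>S\<close>.\<close>

definition walk_rel :: "'v set set \<Rightarrow> 'v set \<Rightarrow> ('v \<times> 'v) set" where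
  "walk_rel E S = {(u, v). u \<in> S \<and> v \<in> S \<and> (u, v) \<in> {(x, y). x \<in> S \<and> y \<in> S \<and> {x, y} \<in> E}\<^sup>*}"

definition is_cycle :: "'v set set \<Rightarrow> 'v list \<Rightarrow> bool" where
  "is_cycle E xs \<longleftrightarrow> length xs \<ge> 3 \<and> distinct xs \<and>
     (\<forall>i < length xs. {xs ! i, xs ! (Suc i mod length xs)} \<in> E)"

definition is_tree :: "'v set \<Rightarrow> 'v set set \<Rightarrow> bool" where
  "is_tree V E \<longleftrightarrow> finite V \<and> V \<noteq> {} \<and> E \<subseteq> {e. e \<subseteq> V \<and> card e = 2} \<and>
     (\<forall>u \<in> V. \<forall>v \<in> V. (u, v) \<in> walk_rel E V) \<and> (\<nexists>xs. is_cycle E xs)"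

text \<open>The vertex sets of the components of \<open>T - v\<close>.\<close>

definition components_minus :: "'v set \<Rightarrow> 'v set set \<Rightarrow> 'v \<Rightarrow> 'v set set" where
  "components_minus V E v = (V - {v}) // walk_rel E (V - {v})"


section \<open>Tree-width\<close>

definition rank_defect :: "'a pre_matroid \<Rightarrow> 'a set \<Rightarrow> int" where
  "rank_defect M B = int (rk M (ground M)) - int (rk M (ground M - B))"

definition tree_decomposition ::
    "'a pre_matroid \<Rightarrow> 'v set \<Rightarrow> 'v set set \<Rightarrow> ('a \<Rightarrow> 'v) \<Rightarrow> bool" where
  "tree_decomposition M V E \<tau> \<longleftrightarrow> is_tree V E \<and> \<tau> ` ground M \<subseteq> V"

definition node_width ::
    "'a pre_matroid \<Rightarrow> 'v set \<Rightarrow> 'v set set \<Rightarrow> ('a \<Rightarrow> 'v) \<Rightarrow> 'v \<Rightarrow> int" where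
  "node_width M V E \<tau> v = int (rk M (ground M)) -
     (\<Sum>C \<in> components_minus V E v. rank_defect M {e \<in> ground M. \<tau> e \<in> C})"

definition decomposition_width ::
    "'a pre_matroid \<Rightarrow> 'v set \<Rightarrow> 'v set set \<Rightarrow> ('a \<Rightarrow> 'v) \<Rightarrow> int" where
  "decomposition_width M V E \<tau> = Max (node_width M V E \<tau> ` V)"

text \<open>Trees are finite, so vertices may be taken to be natural numbers. The infimum
  is a minimum, see \<open>tree_width_attained\<close> and \<open>tree_width_le\<close> below.\<close>

definition tree_widths :: "'a pre_matroid \<Rightarrow> int set" where
  "tree_widths M = {decomposition_width M V E \<tau> | (V :: nat set) E \<tau>. tree_decomposition M V E \<tau>}"

definition tree_width :: "'a pre_matroid \<Rightarrow> int" where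
  "tree_width M = Inf (tree_widths M)"

lemma (in matroid) finite_indeps: "finite (indeps M)"
  by (rule finite_subset[of _ "Pow (ground M)"]) (use finite_ground indeps_subset in auto)

lemma (in matroid) rank_defect_le_card:
  assumes "B \<subseteq> ground M"
  shows "rank_defect M B \<le> int (card B)"
proof -
  have "rk M (ground M) \<in> card ` {I \<in> indeps M. I \<subseteq> ground M}"
    unfolding rk_def using finite_indeps empty_indep by (intro Max_in) auto
  then obtain I where I: "I \<in> indeps M" "card I = rk M (ground M)" by auto
  have finB: "finite B" using assms finite_ground finite_subset by blast
  have "I - B \<in> indeps M" "I - B \<subseteq> ground M - B"
    using I indep_mono indeps_subset by auto
  then have "card (I - B) \<le> rk M (ground M - B)"
    unfolding rk_def using finite_indeps by (intro Max_ge) auto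
  moreover have "card I - card B \<le> card (I - B)" using finB by (rule diff_card_le_card_Diff)
  ultimately show ?thesis using I unfolding rank_defect_def by linarith
qed

lemma equiv_walk_rel: "equiv S (walk_rel E S)"
proof (rule equivI)
  let ?r = "{(x, y). x \<in> S \<and> y \<in> S \<and> {x, y} \<in> E}"
  show "walk_rel E S \<subseteq> S \<times> S" by (auto simp: walk_rel_def)
  show "refl_on S (walk_rel E S)" by (auto simp: walk_rel_def refl_on_def)
  have "sym ?r" by (auto simp: sym_def insert_commute)
  then have "sym (?r\<^sup>*)" by (rule sym_rtrancl)
  then show "sym (walk_rel E S)" by (auto simp: walk_rel_def sym_def)
  show "trans (walk_rel E S)" by (auto simp: walk_rel_def trans_def)
qed

lemma (in matroid) node_width_ge:
  assumes "finite V"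
  shows "node_width M V E \<tau> v \<ge> - int (card (ground M))"
proof -
  let ?C = "components_minus V E v"
  let ?B = "\<lambda>C. {e \<in> ground M. \<tau> e \<in> C}"
  have eq: "equiv (V - {v}) (walk_rel E (V - {v}))" by (rule equiv_walk_rel)
  have finC: "finite ?C" unfolding components_minus_def
    by (rule finite_quotient) (use assms in \<open>auto simp: walk_rel_def\<close>)
  have "(\<Sum>C \<in> ?C. rank_defect M (?B C)) \<le> (\<Sum>C \<in> ?C. int (card (?B C)))"
    by (intro sum_mono rank_defect_le_card) auto
  also have "\<dots> = int (\<Sum>C \<in> ?C. card (?B C))" by simp
  also have "(\<Sum>C \<in> ?C. card (?B C)) = card (\<Union>C \<in> ?C. ?B C)"
  proof (rule card_UN_disjoint[symmetric])
    show "\<forall>C \<in> ?C. \<forall>D \<in> ?C. C \<noteq> D \<longrightarrow> ?B C \<inter> ?B D = {}"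
      using quotient_disj[OF eq] unfolding components_minus_def by blast
  qed (use finC finite_ground in auto)
  also have "\<dots> \<le> int (card (ground M))"
    using finite_ground by (auto intro!: card_mono)
  finally show ?thesis unfolding node_width_def by linarith
qed

lemma (in matroid) tree_widths_bdd_below: "bdd_below (tree_widths M)"
proof (rule bdd_belowI[of _ "- int (card (ground M))"])
  fix w assume "w \<in> tree_widths M"
  then obtain V :: "nat set" and E \<tau> where w: "w = Max (node_width M V E \<tau> ` V)"
    and t: "is_tree V E"
    by (auto simp: tree_widths_def tree_decomposition_def decomposition_width_def)
  then obtain v where "v \<in> V" "finite V" by (auto simp: is_tree_def)
  then have "node_width M V E \<tau> v \<le> w" unfolding w by auto
  with node_width_ge[OF \<open>finite V\<close>] show "- int (card (ground M)) \<le> w" by (rule order_trans)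
qed

lemma tree_widths_nonempty: "tree_widths M \<noteq> {}"
proof -
  have "is_tree {0 :: nat} {}"
    by (auto simp: is_tree_def is_cycle_def walk_rel_def) force
  then have "tree_decomposition M {0 :: nat} {} (\<lambda>_. 0)"
    by (auto simp: tree_decomposition_def)
  then show ?thesis unfolding tree_widths_def by blast
qed

lemma (in matroid) tree_width_le: "w \<in> tree_widths M \<Longrightarrow> tree_width M \<le> w"
  unfolding tree_width_def using tree_widths_bdd_below by (rule cInf_lower[rotated])

lemma (in matroid) tree_width_attained: "tree_width M \<in> tree_widths M"
proof -
  have "Inf (tree_widths M) < tree_width M + 1" by (simp add: tree_width_def)
  then obtain w where w: "w \<in> tree_widths M" "w < tree_width M + 1"
    using cInf_lessD[OF tree_widths_nonempty] by blast
  with tree_width_le have "w = tree_width M" by fastforce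
  with w show ?thesis by simp
qed

end

theory Submission
  imports Defs
begin

text \<open>A matroid of tree-width at most \<open>k\<close> has a set \<open>B\<close> of rank at most \<open>k\<close> whose complement is
  not spanning, so \<open>B\<close> contains a cocircuit. If the matroid is simple without a
  \<open>U(2, q + 2)\<close>-minor, Kung's bound gives \<open>card B \<le> d = (q ^ k - 1) / (q - 1)\<close>. Deletion and
  contraction of the elements of this cocircuit bound the characteristic polynomial at \<open>x\<close> from
  below by \<open>x - d\<close> times that of a hyperplane, provided that it is nonnegative on proper
  minors. The class in question is minor-closed, parallel elements do not change the polynomial, and
  loops make it vanish; so induction gives positivity for \<open>x > d\<close>. All minors are
  represented by their rank functions, and the polynomial by Whitney's subset expansion.\<close>

section \<open>Rank functions\<close>

text \<open>The structure carries no ground set; a pair \<open>r\<close>, \<open>A\<close> stands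
  for the matroid on \<open>A\<close>, so deletion only shrinks \<open>A\<close>.\<close>

locale rank_function =
  fixes r :: "'a set \<Rightarrow> nat"
  assumes rank_empty: "r {} = 0"
    and rank_singleton_le: "r {e} \<le> 1"
    and rank_mono: "X \<subseteq> Y \<Longrightarrow> r X \<le> r Y"
    and rank_submodular: "r (X \<union> Y) + r (X \<inter> Y) \<le> r X + r Y"
begin

lemma rank_insert_le: "r (insert e X) \<le> r X + 1"
  using rank_submodular[of "{e}" X] rank_singleton_le[of e] by simp

lemma rank_insert_ge: "r X \<le> r (insert e X)"
  by (rule rank_mono) auto

lemma rank_union_le: "finite X \<Longrightarrow> r (X \<union> C) \<le> card X + r C"
proof (induction X rule: finite_induct)
  case (insert e X)
  then show ?case using rank_insert_le[of e "X \<union> C"] by simp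
qed simp

text \<open>Monotonicity of closure: \<open>insert e X\<close> and \<open>Z\<close> intersect in a
  superset of \<open>X\<close>, so by submodularity \<open>e\<close> gains no more rank over
  \<open>Z\<close> than over \<open>X\<close>.\<close>

lemma rank_insert_eq_mono:
  assumes "r (insert e X) = r X" "X \<subseteq> Z"
  shows "r (insert e Z) = r Z"
proof -
  have "insert e X \<union> Z = insert e Z" "X \<subseteq> insert e X \<inter> Z" using assms(2) by auto
  then have "r (insert e Z) + r X \<le> r (insert e X) + r Z"
    using rank_submodular[of "insert e X" Z] rank_mono[of X "insert e X \<inter> Z"] by simp
  then show ?thesis using assms(1) rank_insert_ge[of Z e] by simp
qed

lemma rank_union_eq:
  assumes "finite S" "\<And>x. x \<in> S \<Longrightarrow> r (insert x X) = r X"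
  shows "r (S \<union> X) = r X"
  using assms
proof (induction S rule: finite_induct)
  case (insert e S)
  then show ?case using rank_insert_eq_mono[of e X "S \<union> X"] by simp
qed simp

end

text \<open>For monotone \<open>r\<close> the truncated subtraction is exact. Elements of
  \<open>C\<close> become loops instead of disappearing, so the ground set is shrunk
  separately.\<close>

definition contract_rank :: "('a set \<Rightarrow> nat) \<Rightarrow> 'a set \<Rightarrow> 'a set \<Rightarrow> nat" where
  "contract_rank r C X = r (X \<union> C) - r C"

lemma contract_rank_empty [simp]: "r {} = 0 \<Longrightarrow> contract_rank r {} = r"
  by (auto simp: contract_rank_def)

lemma (in rank_function) rank_function_contract: "rank_function (contract_rank r C)"
proof
  show "contract_rank r C {} = 0" by (simp add: contract_rank_def)
  show "contract_rank r C {e} \<le> 1" for e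
    using rank_insert_le[of e C] by (simp add: contract_rank_def)
  show "contract_rank r C X \<le> contract_rank r C Y" if "X \<subseteq> Y" for X Y
    unfolding contract_rank_def by (intro diff_le_mono rank_mono) (use that in auto)
  show "contract_rank r C (X \<union> Y) + contract_rank r C (X \<inter> Y)
      \<le> contract_rank r C X + contract_rank r C Y" for X Y
  proof -
    have "(X \<union> C) \<union> (Y \<union> C) = X \<union> Y \<union> C" "(X \<union> C) \<inter> (Y \<union> C) = X \<inter> Y \<union> C" by auto
    then have "r (X \<union> Y \<union> C) + r (X \<inter> Y \<union> C) \<le> r (X \<union> C) + r (Y \<union> C)"
      using rank_submodular[of "X \<union> C" "Y \<union> C"] by simp
    moreover have "r C \<le> r (X \<inter> Y \<union> C)" "r C \<le> r (X \<union> Y \<union> C)" "r C \<le> r (X \<union> C)" "r C \<le> r (Y \<union> C)"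
      by (auto intro: rank_mono)
    ultimately show ?thesis unfolding contract_rank_def by linarith
  qed
qed

lemma (in rank_function) contract_rank_contract_rank:
  "contract_rank (contract_rank r C) D = contract_rank r (C \<union> D)"
proof
  fix X
  have "r C \<le> r (D \<union> C)" by (auto intro: rank_mono)
  then show "contract_rank (contract_rank r C) D X = contract_rank r (C \<union> D) X"
    by (simp add: contract_rank_def Un_ac)
qed


section \<open>The Whitney sum\<close>

definition whitney_sum :: "('a set \<Rightarrow> nat) \<Rightarrow> 'a set \<Rightarrow> real \<Rightarrow> real" where
  "whitney_sum r A x = (\<Sum>X \<in> Pow A. (-1) ^ card X * x ^ (r A - r X))"

lemma whitney_sum_cong:
  assumes "\<And>X. X \<subseteq> A \<Longrightarrow> r X = s X"
  shows "whitney_sum r A x = whitney_sum s A x"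
  unfolding whitney_sum_def by (rule sum.cong) (use assms in auto)

text \<open>Split the subsets by whether they contain \<open>e\<close>. The power of
  \<open>x\<close> is 1 unless \<open>e\<close> is a coloop, where it supplies the missing factor;
  loops and coloops thus need no separate cases.\<close>

lemma (in rank_function) whitney_sum_insert:
  assumes "finite A" "e \<notin> A"
  shows "whitney_sum r (insert e A) x =
    x ^ (r (insert e A) - r A) * whitney_sum r A x - whitney_sum (contract_rank r {e}) A x"
proof -
  let ?f = "\<lambda>X. (-1) ^ card X * x ^ (r (insert e A) - r X) :: real"
  have "whitney_sum r (insert e A) x = sum ?f (Pow A) + sum ?f (insert e ` Pow A)"
    unfolding whitney_sum_def Pow_insert
    by (rule sum.union_disjoint) (use assms in auto)
  also have "sum ?f (Pow A) = x ^ (r (insert e A) - r A) * whitney_sum r A x"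
    unfolding whitney_sum_def sum_distrib_left
  proof (rule sum.cong)
    fix X assume "X \<in> Pow A"
    then have "r X \<le> r A" "r A \<le> r (insert e A)" by (auto intro: rank_mono)
    then show "?f X = x ^ (r (insert e A) - r A) * ((-1) ^ card X * x ^ (r A - r X))"
      by (simp add: power_add[symmetric])
  qed simp
  also have "sum ?f (insert e ` Pow A) = (\<Sum>X \<in> Pow A. ?f (insert e X))"
    by (subst sum.reindex) (use assms in \<open>auto simp: inj_on_def\<close>)
  also have "\<dots> = - whitney_sum (contract_rank r {e}) A x"
    unfolding whitney_sum_def sum_negf[symmetric]
  proof (rule sum.cong)
    fix X assume X: "X \<in> Pow A"
    then have "finite X" "e \<notin> X" using assms finite_subset by auto
    moreover have "r {e} \<le> r (insert e X)" by (auto intro: rank_mono)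
    ultimately show "?f (insert e X) = - ((-1) ^ card X *
        x ^ (contract_rank r {e} A - contract_rank r {e} X))"
      by (simp add: contract_rank_def)
  qed simp
  finally show ?thesis by simp
qed

text \<open>Contracting a loop is the same as deleting it, so the two terms of deletion-contraction
  cancel.\<close>

lemma (in rank_function) whitney_sum_loop:
  assumes "finite A" "e \<in> A" "r {e} = 0"
  shows "whitney_sum r A x = 0"
proof -
  have eq: "r (insert e X) = r X" for X
    using rank_insert_eq_mono[of e "{}" X] assms rank_empty by simp
  have "whitney_sum (contract_rank r {e}) (A - {e}) x = whitney_sum r (A - {e}) x"
    by (rule whitney_sum_cong) (simp add: contract_rank_def eq assms rank_empty)
  then show ?thesis
    using whitney_sum_insert[of "A - {e}" e x] assms eq[of "A - {e}"] by (simp add: insert_absorb)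
qed

text \<open>Adding the elements of a cocircuit \<open>D\<close> back to its hyperplane \<open>H\<close> one at a time, the first
  acts as a coloop (factor \<open>x - 1\<close>), and every further one costs at most one more
  copy of the Whitney sum of \<open>H\<close>.\<close>

lemma whitney_sum_pos:
  fixes K :: "('a set \<Rightarrow> nat) \<Rightarrow> 'a set \<Rightarrow> bool" and x d :: real
  assumes K_rank: "\<And>r A. K r A \<Longrightarrow> rank_function r \<and> finite A"
    and K_delete: "\<And>r A e. K r A \<Longrightarrow> e \<in> A \<Longrightarrow> K r (A - {e})"
    and K_contract: "\<And>r A e. K r A \<Longrightarrow> e \<in> A \<Longrightarrow> K (contract_rank r {e}) (A - {e})"
    and cocircuit: "\<And>r A. K r A \<Longrightarrow> A \<noteq> {} \<Longrightarrow> (\<forall>a \<in> A. r {a} = 1) \<Longrightarrow>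
      (\<forall>a \<in> A. \<forall>b \<in> A. a \<noteq> b \<longrightarrow> r {a, b} = 2) \<Longrightarrow>
      \<exists>H \<subseteq> A. r H < r A \<and> (\<forall>e \<in> A - H. r (insert e H) = r A) \<and> card (A - H) \<le> d"
    and x: "x > d"
    and KA: "K r A" and loopless: "\<forall>a \<in> A. r {a} = 1"
  shows "whitney_sum r A x > 0"
  using KA loopless
proof (induction "card A" arbitrary: r A rule: less_induct)
  case less
  interpret rank_function r using K_rank less.prems by blast
  have finA: "finite A" using K_rank less.prems by blast
  \<comment> \<open>The contractions used below may have loops, where the sum vanishes; hence a weak
    inequality for all smaller members of the class.\<close>
  have nonneg: "whitney_sum s B x \<ge> 0" if "K s B" "card B < card A" for s B
  proof (cases "\<forall>b \<in> B. s {b} = 1")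
    case True
    then show ?thesis using less.hyps[of B s] that by simp
  next
    case False
    interpret s: rank_function s using K_rank that by blast
    from False obtain b where "b \<in> B" "s {b} \<noteq> 1" by blast
    moreover from this have "s {b} = 0" using s.rank_singleton_le[of b] by simp
    ultimately show ?thesis using s.whitney_sum_loop K_rank that by fastforce
  qed
  consider (empty) "A = {}"
    | (parallel) a b where "a \<in> A" "b \<in> A" "a \<noteq> b" "r {a, b} \<noteq> 2"
    | (simple) "A \<noteq> {}" "\<forall>a \<in> A. \<forall>b \<in> A. a \<noteq> b \<longrightarrow> r {a, b} = 2"
    by blast
  then show ?case
  proof cases
    case empty
    then show ?thesis by (simp add: whitney_sum_def)
  next
    case (parallel a b)
    then have ab: "r {a, b} = r {a}" "r {a} = 1" "r {b} = 1"
      using rank_insert_le[of b "{a}"] rank_insert_ge[of "{a}" b] less.prems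
      by (auto simp: insert_commute)
    \<comment> \<open>Removing \<open>b\<close> keeps the rank because \<open>a\<close> remains, and
      contracting \<open>b\<close> turns \<open>a\<close> into a loop; only the deletion term
      survives.\<close>
    have "r (insert b (A - {b})) = r (A - {b})"
      by (rule rank_insert_eq_mono[of b "{a}"]) (use ab parallel in \<open>auto simp: insert_commute\<close>)
    moreover have "whitney_sum (contract_rank r {b}) (A - {b}) x = 0"
      by (rule rank_function.whitney_sum_loop[OF rank_function_contract, where e = a])
        (use parallel finA ab in \<open>auto simp: contract_rank_def insert_commute\<close>)
    ultimately have "whitney_sum r A x = whitney_sum r (A - {b}) x"
      using whitney_sum_insert[of "A - {b}" b x] parallel finA by (simp add: insert_absorb)
    moreover have "whitney_sum r (A - {b}) x > 0"
      by (rule less.hyps[OF card_Diff1_less[OF finA parallel(2)]])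
        (use parallel less.prems K_delete in auto)
    ultimately show ?thesis by simp
  next
    case simple
    then obtain H where H: "H \<subseteq> A" "r H < r A" "\<And>e. e \<in> A - H \<Longrightarrow> r (insert e H) = r A"
      and card_le: "card (A - H) \<le> d"
      using cocircuit[OF less.prems(1)] less.prems(2) by blast
    have K_restrict: "K s B" if KA': "K s A'" and "B \<subseteq> A'" for s A' B
    proof -
      have "K s (A' - D)" if "finite D" for D
        using that
      proof (induction D rule: finite_induct)
        case (insert e D)
        have "A' - insert e D = A' - D - {e}" by auto
        then show ?case using K_delete[of s "A' - D" e] insert
          by (cases "e \<in> A' - D") auto
      qed (use KA' in simp)
      from this[of "A' - B"] show ?thesis using that K_rank by (simp add: double_diff)
    qed
    have finH: "finite H" using H finA finite_subset by blast
    have ne: "A - H \<noteq> {}" using H by auto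
    have rA: "r A = r H + 1" 
    proof -
      obtain e where "e \<in> A - H" using ne by blast
      then show ?thesis using H(2,3) rank_insert_le[of e H] by fastforce
    qed
    have full: "r (H \<union> D) = r A" if D: "D \<subseteq> A - H" "D \<noteq> {}" for D
    proof -
      obtain e where e: "e \<in> D" using D(2) by blast
      have "r (insert e H) \<le> r (H \<union> D)" "r (H \<union> D) \<le> r A"
        by (rule rank_mono; use D(1) e H(1) in blast)+
      then show ?thesis using H(3)[of e] e D by auto
    qed
    \<comment> \<open>\<open>e\<close> is outside the closure of \<open>H\<close>, hence outside
      that of every subset of \<open>H\<close>: contracting \<open>e\<close> does not change the
      matroid on \<open>H\<close>.\<close>
    have contract_eq: "contract_rank r {e} X = r X" if "e \<in> A - H" "X \<subseteq> H" for e X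
    proof -
      have "r (insert e X) \<noteq> r X"
        using rank_insert_eq_mono[of e X H] H(2,3) that by auto
      then have "r (insert e X) = r X + 1"
        using rank_insert_le[of e X] rank_insert_ge[of X e] by simp
      moreover have "r {e} = 1" using that less.prems by blast
      ultimately show ?thesis by (simp add: contract_rank_def)
    qed
    \<comment> \<open>After contracting \<open>e\<close> the set \<open>H\<close> is spanning, so no
      further \<open>f\<close> raises the rank, and deletion-contraction at \<open>f\<close> merely
      subtracts a nonnegative sum.\<close>
    have contract_le: "whitney_sum (contract_rank r {e}) (H \<union> D) x \<le> whitney_sum r H x"
      if "e \<in> A - H" "D \<subseteq> A - H - {e}" for e D
    proof -
      let ?s = "contract_rank r {e}"
      interpret s: rank_function ?s by (rule rank_function_contract)
      have Ks: "K ?s (A - {e})" using K_contract less.prems that by blast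
      have "finite D" using that finA finite_subset by blast
      then show ?thesis using that(2)
      proof (induction D rule: finite_induct)
        case empty
        have "whitney_sum ?s H x = whitney_sum r H x"
          by (rule whitney_sum_cong) (use contract_eq that in blast)
        then show ?case by simp
      next
        case (insert f D)
        have f: "f \<notin> H \<union> D" "f \<in> A" "f \<noteq> e" using insert by auto
        have "?s (insert f (H \<union> D)) = ?s (H \<union> D)"
        proof -
          have "r (H \<union> insert e D) = r A" "r (H \<union> insert e (insert f D)) = r A"
            by (rule full; use insert that in blast)+
          then show ?thesis by (simp add: contract_rank_def insert_commute)
        qed
        moreover have "whitney_sum (contract_rank ?s {f}) (H \<union> D) x \<ge> 0"
        proof (rule nonneg)
          have "K ?s (insert f (H \<union> D))"
            by (rule K_restrict[OF Ks]) (use insert H that in auto)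
          from K_contract[OF this, of f] show "K (contract_rank ?s {f}) (H \<union> D)" using f by auto
          show "card (H \<union> D) < card A"
            by (rule psubset_card_mono) (use finA f H insert in auto)
        qed
        ultimately show ?case
          using s.whitney_sum_insert[of "H \<union> D" f x] finH insert f by simp
      qed
    qed
    have "whitney_sum r (H \<union> D) x \<ge> (x - card D) * whitney_sum r H x"
      if "finite D" "D \<noteq> {}" "D \<subseteq> A - H" for D
      using that
    proof (induction D rule: finite_ne_induct)
      case (singleton e)
      have "whitney_sum (contract_rank r {e}) H x = whitney_sum r H x"
        by (rule whitney_sum_cong) (use contract_eq singleton in blast)
      moreover have "r (insert e H) - r H = 1" using singleton H rA by auto
      ultimately show ?case
        using whitney_sum_insert[of H e x] singleton finH by (simp add: algebra_simps)
    next
      case (insert e D)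
      have "r (insert e (H \<union> D)) = r (H \<union> D)"
        using full[of D] full[of "insert e D"] insert by simp
      moreover have "whitney_sum (contract_rank r {e}) (H \<union> D) x \<le> whitney_sum r H x"
        by (rule contract_le) (use insert in auto)
      moreover have "e \<notin> H \<union> D" using insert by auto
      ultimately show ?case
        using whitney_sum_insert[of "H \<union> D" e x] insert finH by (simp add: algebra_simps)
    qed
    from this[of "A - H"] have "(x - card (A - H)) * whitney_sum r H x \<le> whitney_sum r A x"
      using ne finA H by (simp add: Un_absorb1)
    moreover have "whitney_sum r H x > 0"
    proof (rule less.hyps)
      show "card H < card A" by (rule psubset_card_mono) (use finA H ne in auto)
    qed (use K_restrict less.prems H in auto)
    moreover have "x - card (A - H) > 0" using card_le x by simp
    ultimately show ?thesis by (meson mult_pos_pos less_le_trans)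
  qed
qed


section \<open>Excluding long lines\<close>

text \<open>The excluded minor in terms of ranks: the deletion is implicit in the choice of
  \<open>S\<close>, and rank 2 on pairs rules out loops as well as parallel elements.\<close>

definition no_long_line :: "nat \<Rightarrow> ('a set \<Rightarrow> nat) \<Rightarrow> 'a set \<Rightarrow> bool" where
  "no_long_line q r A \<longleftrightarrow> (\<forall>C S. C \<subseteq> A \<and> S \<subseteq> A - C \<and> card S = q + 2 \<and>
     (\<forall>a \<in> S. \<forall>b \<in> S. a \<noteq> b \<longrightarrow> contract_rank r C {a, b} = 2) \<longrightarrow> contract_rank r C S \<noteq> 2)"

lemma no_long_line_subset: "no_long_line q r A \<Longrightarrow> B \<subseteq> A \<Longrightarrow> no_long_line q r B"
  unfolding no_long_line_def by (elim all_forward imp_forward conj_forward) auto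

lemma (in rank_function) no_long_line_contract:
  assumes "no_long_line q r A" "e \<in> A"
  shows "no_long_line q (contract_rank r {e}) (A - {e})"
  unfolding no_long_line_def contract_rank_contract_rank
proof (intro allI impI, elim conjE)
  fix C S
  assume "C \<subseteq> A - {e}" "S \<subseteq> A - {e} - C" "card S = q + 2"
    "\<forall>a \<in> S. \<forall>b \<in> S. a \<noteq> b \<longrightarrow> contract_rank r ({e} \<union> C) {a, b} = 2"
  moreover from this have "{e} \<union> C \<subseteq> A" "S \<subseteq> A - ({e} \<union> C)" using assms by auto
  ultimately show "contract_rank r ({e} \<union> C) S \<noteq> 2"
    using assms(1) unfolding no_long_line_def by blast
qed

text \<open>Kung's bound: every line through a point \<open>e\<close> carries at most \<open>q\<close> further points,
  and the lines through \<open>e\<close> are the points of the contraction by \<open>e\<close>.\<close>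

lemma card_simple_le:
  assumes "rank_function r" "finite A" "no_long_line q r A"
    and "\<forall>a \<in> A. r {a} = 1" "\<forall>a \<in> A. \<forall>b \<in> A. a \<noteq> b \<longrightarrow> r {a, b} = 2"
    and "r A \<le> k"
  shows "card A \<le> (\<Sum>i<k. q ^ i)"
  using assms
proof (induction k arbitrary: r A)
  case 0
  interpret rank_function r by fact
  have "A = {}"
  proof (rule ccontr)
    assume "A \<noteq> {}"
    then obtain a where "a \<in> A" by blast
    then show False using rank_mono[of "{a}" A] 0 by auto
  qed
  then show ?case by simp
next
  case (Suc k)
  interpret rank_function r by fact
  show ?case
  proof (cases "A = {}")
    case False
    then obtain e where e: "e \<in> A" by blast
    let ?s = "contract_rank r {e}"
    interpret s: rank_function ?s by (rule rank_function_contract)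
    have s1: "?s {a} = 1" if "a \<in> A - {e}" for a
    proof -
      have "r {e} = 1" "r {a, e} = 2" using Suc.prems(4,5) that e by auto
      then show ?thesis by (simp add: contract_rank_def insert_commute)
    qed
    \<comment> \<open>A maximal such set has one element from each parallel class of the
      contraction, that is, one point on each line through \<open>e\<close>.\<close>
    define simple where "simple B \<longleftrightarrow> B \<subseteq> A - {e} \<and> (\<forall>a \<in> B. \<forall>b \<in> B. a \<noteq> b \<longrightarrow> ?s {a, b} = 2)" for B
    have "finite {B. simple B}"
      by (rule finite_subset[of _ "Pow A"]) (use Suc.prems in \<open>auto simp: simple_def\<close>)
    moreover have "simple {}" by (simp add: simple_def)
    ultimately obtain B where B: "simple B" and maxB: "\<And>B'. simple B' \<Longrightarrow> B \<subseteq> B' \<Longrightarrow> B = B'"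
      using finite_has_maximal[of "{B. simple B}"] by blast
    have BA: "B \<subseteq> A - {e}" and finB: "finite B"
      using B Suc.prems(2) finite_subset[of B A] by (auto simp: simple_def)
    \<comment> \<open>The points other than \<open>e\<close> on the line through \<open>e\<close>
      and \<open>b\<close>; for \<open>b\<close> in \<open>B\<close> they include \<open>b\<close>
      itself.\<close>
    define L where "L b = {x \<in> A - {e}. ?s {b, x} = 1}" for b
    have card_L: "card (L b) \<le> q" if b: "b \<in> B" for b
    proof (rule ccontr)
      assume "\<not> card (L b) \<le> q"
      \<comment> \<open>Exactly \<open>q + 1\<close> points, so that adding \<open>e\<close> gives
        the \<open>q + 2\<close> points of a forbidden line, here with nothing contracted.\<close>
      then obtain T where T: "T \<subseteq> L b" "card T = q + 1"
        by (metis Suc_eq_plus1 not_less_eq_eq obtain_subset_with_card_n)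
      have TA: "T \<subseteq> A - {e}" using T by (auto simp: L_def)
      have finT: "finite T" using TA Suc.prems(2) finite_subset by blast
      have sb: "?s {b} = 1" by (rule s1) (use b BA in blast)
      have "?s (T \<union> {b}) = ?s {b}"
      proof (rule s.rank_union_eq[OF finT])
        fix x assume "x \<in> T"
        then have "?s {b, x} = 1" using T by (auto simp: L_def)
        then show "?s (insert x {b}) = ?s {b}" using sb by (simp add: insert_commute)
      qed
      moreover have "?s T \<le> ?s (T \<union> {b})" by (rule s.rank_mono) auto
      ultimately have "?s T \<le> 1" using sb by simp
      moreover obtain t where t: "t \<in> T" using T by fastforce
      moreover have "?s {t} \<le> ?s T" by (rule s.rank_mono) (use t in auto)
      ultimately have "?s T = 1" using s1[of t, OF subsetD[OF TA t]] by simp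
      then have "r (insert e T) = 2" using Suc.prems(4) e by (simp add: contract_rank_def)
      moreover have "card (insert e T) = q + 2" using T TA finT by (subst card_insert_disjoint) auto
      moreover have "insert e T \<subseteq> A" using TA e by auto
      moreover from this have "\<forall>a \<in> insert e T. \<forall>b \<in> insert e T. a \<noteq> b \<longrightarrow> r {a, b} = 2"
        using Suc.prems(5) by blast
      ultimately show False
        using Suc.prems(3)[unfolded no_long_line_def, rule_format, of "{}" "insert e T"] rank_empty
        by simp
    qed
    have cover: "A \<subseteq> insert e (\<Union>b \<in> B. L b)"
    proof
      fix x assume x: "x \<in> A"
      show "x \<in> insert e (\<Union>b \<in> B. L b)"
      proof (rule ccontr)
        assume n: "x \<notin> insert e (\<Union>b \<in> B. L b)"
        then have xe: "x \<in> A - {e}" using x by auto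
        have two: "?s {b, x} = 2" if "b \<in> B" for b
        proof -
          have "?s {b, x} \<noteq> 1" using n that xe by (auto simp: L_def)
          moreover have "?s {x} \<le> ?s {b, x}" "?s {b, x} \<le> ?s {x} + 1"
            using s.rank_insert_le s.rank_insert_ge by auto
          ultimately show ?thesis using s1[OF xe] by simp
        qed
        have "simple (insert x B)"
          unfolding simple_def
        proof (intro conjI ballI impI)
          show "insert x B \<subseteq> A - {e}" using BA xe by auto
          fix a b assume "a \<in> insert x B" "b \<in> insert x B" "a \<noteq> b"
          then consider "a \<in> B" "b \<in> B" | "a \<in> B" "b = x" | "a = x" "b \<in> B" by blast
          then show "?s {a, b} = 2"
          proof cases
            case 1
            then show ?thesis using B \<open>a \<noteq> b\<close> by (simp add: simple_def)
          next
            case 2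
            then show ?thesis using two by simp
          next
            case 3
            then show ?thesis using two[of b] by (simp add: insert_commute)
          qed
        qed
        then have "x \<in> B" using maxB by blast
        then show False using n xe s1[OF xe] by (auto simp: L_def)
      qed
    qed
    have "card B \<le> (\<Sum>i<k. q ^ i)"
    proof (rule Suc.IH[of ?s])
      show "no_long_line q ?s B"
        using no_long_line_subset no_long_line_contract Suc.prems(3) e BA by blast
      have "r (insert e B) \<le> r A" by (rule rank_mono) (use BA e in auto)
      then show "?s B \<le> k" using Suc.prems e by (simp add: contract_rank_def)
    qed (use B BA s1 finB s.rank_function_axioms in \<open>auto simp: simple_def\<close>)
    have finL: "finite (L b)" for b using Suc.prems(2) by (auto simp: L_def)
    have "card A \<le> card (insert e (\<Union>b \<in> B. L b))"
      by (rule card_mono) (use finB finL cover in auto)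
    also have "\<dots> \<le> Suc (card (\<Union>b \<in> B. L b))"
      by (rule card_insert_le_m1) auto
    also have "card (\<Union>b \<in> B. L b) \<le> (\<Sum>b \<in> B. card (L b))"
      using finB by (rule card_UN_le)
    also have "\<dots> \<le> (\<Sum>b \<in> B. q)" using card_L by (rule sum_mono)
    also have "\<dots> \<le> q * (\<Sum>i<k. q ^ i)" using \<open>card B \<le> _\<close> by simp
    also have "Suc (q * (\<Sum>i<k. q ^ i)) = (\<Sum>i<Suc k. q ^ i)"
      by (simp add: sum.lessThan_Suc_shift sum_distrib_left del: sum.lessThan_Suc)
    finally show ?thesis by simp
  qed simp
qed


section \<open>Trees\<close>

definition adj_rel :: "'v set set \<Rightarrow> 'v set \<Rightarrow> ('v \<times> 'v) set" where
  "adj_rel E S = {(x, y). x \<in> S \<and> y \<in> S \<and> {x, y} \<in> E}"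

lemma walk_rel_iff: "(u, v) \<in> walk_rel E S \<longleftrightarrow> u \<in> S \<and> v \<in> S \<and> (u, v) \<in> (adj_rel E S)\<^sup>*"
  by (simp add: walk_rel_def adj_rel_def)

lemma rtrancl_crossing:
  assumes "(a, b) \<in> R\<^sup>*" "a \<in> S" "b \<notin> S"
  obtains x y where "(x, y) \<in> R" "x \<in> S" "y \<notin> S"
  using assms by (induction rule: rtrancl_induct) auto

text \<open>Whenever the walk returns to a visited vertex, the path is cut back to that vertex.
  \<open>insert a S\<close> allows for the empty walk, whose start need not lie in
  \<open>S\<close>.\<close>

lemma distinct_path:
  assumes "(a, b) \<in> (adj_rel E S)\<^sup>*"
  shows "\<exists>xs. xs \<noteq> [] \<and> hd xs = a \<and> last xs = b \<and> distinct xs \<and> set xs \<subseteq> insert a S \<and>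
    successively (\<lambda>x y. {x, y} \<in> E) xs"
  using assms
proof (induction rule: rtrancl_induct)
  case base
  show ?case by (rule exI[of _ "[a]"]) auto
next
  case (step y z)
  then obtain xs where xs: "xs \<noteq> []" "hd xs = a" "last xs = y" "distinct xs" "set xs \<subseteq> insert a S"
    "successively (\<lambda>x y. {x, y} \<in> E) xs" by blast
  have z: "z \<in> S" "{y, z} \<in> E" using step.hyps by (auto simp: adj_rel_def)
  show ?case
  proof (cases "z \<in> set xs")
    case True
    then obtain ys zs where eq: "xs = ys @ z # zs" by (meson split_list)
    have "hd (ys @ [z]) = a" using xs(2) eq by (cases ys) auto
    moreover have "distinct (ys @ [z])" "set (ys @ [z]) \<subseteq> insert a S"
      using xs(4,5) eq by auto
    moreover have "successively (\<lambda>x y. {x, y} \<in> E) (ys @ [z])"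
      using xs(6) eq by (auto simp: successively_append_iff)
    ultimately show ?thesis by (intro exI[of _ "ys @ [z]"]) simp
  next
    case False
    show ?thesis
      by (rule exI[of _ "xs @ [z]"]) (use xs z False in \<open>auto simp: successively_append_iff\<close>)
  qed
qed

text \<open>Closes a path through a new vertex. Distinct ends give the path at least two vertices,
  hence the cycle the required three.\<close>

lemma is_cycle_Cons:
  assumes "xs \<noteq> []" "distinct xs" "v \<notin> set xs" "hd xs \<noteq> last xs"
    and "successively (\<lambda>x y. {x, y} \<in> E) xs" "{v, hd xs} \<in> E" "{last xs, v} \<in> E"
  shows "is_cycle E (v # xs)"
  unfolding is_cycle_def
proof (intro conjI allI impI)
  have len: "length xs \<ge> 2" using assms(1,4) by (cases xs rule: remdups_adj.cases) auto
  then show "length (v # xs) \<ge> 3" by simp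
  show "distinct (v # xs)" using assms by simp
  fix i assume i: "i < length (v # xs)"
  show "{(v # xs) ! i, (v # xs) ! (Suc i mod length (v # xs))} \<in> E"
  proof (cases "Suc i = length (v # xs)")
    case True
    then have "(v # xs) ! i = last xs" using assms(1) by (simp add: last_conv_nth nth_Cons')
    then show ?thesis using True assms by simp
  next
    case False
    then have m: "Suc i mod length (v # xs) = Suc i" using i by simp
    show ?thesis
    proof (cases i)
      case 0
      then show ?thesis unfolding m using assms by (simp add: hd_conv_nth)
    next
      case (Suc j)
      then show ?thesis unfolding m using assms(5) i False by (simp add: successively_conv_nth)
    qed
  qed
qed

section \<open>The components of a tree minus a vertex\<close>

context
  fixes V :: "'v set" and E :: "'v set set" and v :: 'v and C :: "'v set"
  assumes tree: "is_tree V E" and v: "v \<in> V" and C: "C \<in> components_minus V E v"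
begin

lemma component_subset: "C \<subseteq> V - {v}"
  using in_quotient_imp_subset[OF equiv_walk_rel] C by (auto simp: components_minus_def)

lemma component_nonempty: "C \<noteq> {}"
  using in_quotient_imp_non_empty[OF equiv_walk_rel] C by (auto simp: components_minus_def)

lemma component_walk: "x \<in> C \<Longrightarrow> y \<in> C \<Longrightarrow> (x, y) \<in> walk_rel E (V - {v})"
  using in_quotient_imp_in_rel[OF equiv_walk_rel, of C "V - {v}" E x y] C
  by (simp add: components_minus_def)

lemma component_closed:
  assumes "x \<in> C" "y \<in> V - {v}" "{x, y} \<in> E"
  shows "y \<in> C"
proof (rule in_quotient_imp_closed[OF equiv_walk_rel])
  show "C \<in> (V - {v}) // walk_rel E (V - {v})" using C by (simp add: components_minus_def)
  show "x \<in> C" by fact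
  have "x \<in> V - {v}" using component_subset assms by blast
  then show "(x, y) \<in> walk_rel E (V - {v})"
    using assms by (auto simp: walk_rel_iff adj_rel_def)
qed

text \<open>A walk from \<open>C\<close> to \<open>v\<close> has a step leaving \<open>C\<close>;
  since \<open>C\<close> is closed under edges avoiding \<open>v\<close>, that step ends in
  \<open>v\<close>.\<close>

lemma component_attached: "\<exists>u \<in> C. {u, v} \<in> E"
proof -
  obtain w where w: "w \<in> C" using component_nonempty by blast
  then have "(w, v) \<in> (adj_rel E V)\<^sup>*"
    using tree v component_subset by (auto simp: is_tree_def walk_rel_iff)
  then obtain x y where xy: "(x, y) \<in> adj_rel E V" "x \<in> C" "y \<notin> C"
    using rtrancl_crossing[of w v _ C] w component_subset by blast
  then have "y = v" using component_closed[of x y] by (auto simp: adj_rel_def)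
  then show ?thesis using xy by (auto simp: adj_rel_def)
qed

text \<open>Two distinct attached vertices would be joined by a path avoiding \<open>v\<close>,
  which \<open>v\<close> would close to a cycle.\<close>

lemma component_attached_unique:
  assumes "u \<in> C" "{u, v} \<in> E" "w \<in> C" "{w, v} \<in> E"
  shows "u = w"
proof (rule ccontr)
  assume "u \<noteq> w"
  have "(u, w) \<in> (adj_rel E (V - {v}))\<^sup>*"
    using component_walk assms by (auto simp: walk_rel_iff)
  then obtain xs where xs: "xs \<noteq> []" "hd xs = u" "last xs = w" "distinct xs"
    "set xs \<subseteq> insert u (V - {v})" "successively (\<lambda>x y. {x, y} \<in> E) xs"
    using distinct_path[of u w E "V - {v}"] by blast
  have "v \<notin> set xs" using xs assms component_subset by blast
  then have "is_cycle E (v # xs)"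
    by (intro is_cycle_Cons) (use xs assms \<open>u \<noteq> w\<close> in \<open>auto simp: insert_commute\<close>)
  then show False using tree by (auto simp: is_tree_def)
qed

end

text \<open>Every vertex on the walk is itself reachable from \<open>w\<close>, so the walk never
  leaves the class.\<close>

lemma walk_within_class:
  assumes "(w, x) \<in> walk_rel E S"
  shows "(w, x) \<in> (adj_rel E (walk_rel E S `` {w}))\<^sup>*"
proof -
  have w: "w \<in> S" and "(w, x) \<in> (adj_rel E S)\<^sup>*" using assms by (auto simp: walk_rel_iff)
  from this(2) show ?thesis
  proof (induction rule: rtrancl_induct)
    case (step y z)
    then have "(y, z) \<in> adj_rel E (walk_rel E S `` {w})"
      using w by (auto simp: adj_rel_def walk_rel_iff intro: rtrancl_into_rtrancl)
    with step.IH show ?case by (rule rtrancl_into_rtrancl)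
  qed simp
qed

text \<open>The edge joining \<open>v\<close> to \<open>C\<close> separates \<open>C\<close> from
  the rest of the tree. With \<open>u\<close> its end in \<open>C\<close>, the rest is a single
  component of \<open>T - u\<close>.\<close>

lemma complement_component:
  assumes tree: "is_tree V E" and v: "v \<in> V" and C: "C \<in> components_minus V E v"
  obtains u where "u \<in> C" "V - C \<in> components_minus V E u"
proof -
  note CV = component_subset[OF tree v C]
  obtain u where u: "u \<in> C" "{u, v} \<in> E" using component_attached[OF tree v C] by blast
  have uv: "u \<noteq> v" "v \<in> V - {u}" "v \<notin> C" using CV u v by auto
  have "walk_rel E (V - {u}) `` {v} = V - C"
  proof
    show "walk_rel E (V - {u}) `` {v} \<subseteq> V - C"
    proof
      fix y assume "y \<in> walk_rel E (V - {u}) `` {v}"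
      then have y: "y \<in> V" "(v, y) \<in> (adj_rel E (V - {u}))\<^sup>*" by (auto simp: walk_rel_iff)
      \<comment> \<open>The only edge leading into \<open>C\<close> is the one from \<open>v\<close>
        to \<open>u\<close>, and \<open>u\<close> has been removed.\<close>
      have "y \<notin> C"
      proof
        assume "y \<in> C"
        then obtain a b where ab: "(a, b) \<in> adj_rel E (V - {u})" "a \<in> - C" "b \<notin> - C"
          using rtrancl_crossing[OF y(2), of "- C"] uv by blast
        then have "a = v"
          using component_closed[OF tree v C, of b a] by (auto simp: adj_rel_def insert_commute)
        then have "b = u"
          using component_attached_unique[OF tree v C u, of b] ab
          by (auto simp: adj_rel_def insert_commute)
        then show False using ab by (auto simp: adj_rel_def)
      qed
      then show "y \<in> V - C" using y by simp
    qed
    show "V - C \<subseteq> walk_rel E (V - {u}) `` {v}"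
    proof
      fix w assume w: "w \<in> V - C"
      show "w \<in> walk_rel E (V - {u}) `` {v}"
      proof (cases "w = v")
        case True
        then show ?thesis using uv by (auto simp: walk_rel_iff)
      next
        case False
        \<comment> \<open>Inside its own component of \<open>T - v\<close>, walk from
          \<open>w\<close> to the vertex attached to \<open>v\<close>, then to \<open>v\<close>;
          this avoids \<open>u\<close> because the component is disjoint from
          \<open>C\<close>.\<close>
        define D where "D = walk_rel E (V - {v}) `` {w}"
        have D: "D \<in> components_minus V E v"
          unfolding D_def components_minus_def by (rule quotientI) (use w False in auto)
        have "w \<in> D" using w False by (auto simp: D_def walk_rel_iff)
        then have "D \<noteq> C" using w by auto
        then have disj: "D \<inter> C = {}"
          using quotient_disj[OF equiv_walk_rel] C D unfolding components_minus_def by blast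
        note DV = component_subset[OF tree v D]
        obtain x where x: "x \<in> D" "{x, v} \<in> E" using component_attached[OF tree v D] by blast
        have "(w, x) \<in> (adj_rel E D)\<^sup>*"
          using walk_within_class[of w x E "V - {v}"] x unfolding D_def by blast
        also have "adj_rel E D \<subseteq> adj_rel E (V - {u})"
          using DV disj u by (auto simp: adj_rel_def)
        then have "(adj_rel E D)\<^sup>* \<subseteq> (adj_rel E (V - {u}))\<^sup>*" by (rule rtrancl_mono)
        finally have "(w, x) \<in> (adj_rel E (V - {u}))\<^sup>*" .
        moreover have "(x, v) \<in> adj_rel E (V - {u})"
          using x DV disj u uv by (auto simp: adj_rel_def)
        ultimately have "(w, v) \<in> walk_rel E (V - {u})"
          using w uv u by (auto simp: walk_rel_iff)
        then show ?thesis using equiv_walk_rel[of "V - {u}" E] by (auto simp: equiv_def dest: symD)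
      qed
    qed
  qed
  moreover have "walk_rel E (V - {u}) `` {v} \<in> components_minus V E u"
    unfolding components_minus_def by (rule quotientI) (use uv in auto)
  ultimately show ?thesis using that u by simp
qed


section \<open>Tree-width\<close>

text \<open>Asks for a witness rather than an infimum, so that a minor can reuse the tree and the
  map. The summands are the rank defects of the parts.\<close>

definition tree_width_at_most :: "nat \<Rightarrow> ('a set \<Rightarrow> nat) \<Rightarrow> 'a set \<Rightarrow> bool" where
  "tree_width_at_most k r A \<longleftrightarrow> (\<exists>(V :: nat set) E \<tau>. is_tree V E \<and> \<tau> ` A \<subseteq> V \<and>
     (\<forall>v \<in> V. int (r A) - (\<Sum>C \<in> components_minus V E v.
        int (r A) - int (r (A - {e \<in> A. \<tau> e \<in> C}))) \<le> int k))"

lemma finite_components_minus: "finite V \<Longrightarrow> finite (components_minus V E v)"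
  unfolding components_minus_def by (rule finite_quotient) (auto simp: walk_rel_def)

lemma components_minus_disjoint:
  "C \<in> components_minus V E v \<Longrightarrow> D \<in> components_minus V E v \<Longrightarrow> C \<noteq> D \<Longrightarrow> C \<inter> D = {}"
  unfolding components_minus_def using quotient_disj[OF equiv_walk_rel] by blast

text \<open>Rank defects drop only for the one set \<open>B\<close> that contains the removed element \<open>e\<close>, and there
  by no more than the total rank does.\<close>

lemma tree_width_at_most_remove:
  assumes tw: "tree_width_at_most k r A" and le: "s (A - {e}) \<le> r A"
    and defect: "\<And>B. B \<subseteq> A \<Longrightarrow> int (r A) - int (r (A - B)) -
      (if e \<in> B then int (r A) - int (s (A - {e})) else 0)
      \<le> int (s (A - {e})) - int (s (A - {e} - B))"
  shows "tree_width_at_most k s (A - {e})"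
proof -
  obtain V :: "nat set" and E \<tau> where T: "is_tree V E" "\<tau> ` A \<subseteq> V"
    and width: "\<forall>v \<in> V. int (r A) - (\<Sum>C \<in> components_minus V E v.
        int (r A) - int (r (A - {e \<in> A. \<tau> e \<in> C}))) \<le> int k"
    using tw unfolding tree_width_at_most_def by (elim exE conjE) (rule that)
  note w = bspec[OF width]
  let ?d = "int (r A) - int (s (A - {e}))"
  let ?B = "\<lambda>C. {e \<in> A. \<tau> e \<in> C}"
  have "int (s (A - {e})) - (\<Sum>C \<in> components_minus V E v.
      int (s (A - {e})) - int (s (A - {e} - {a \<in> A - {e}. \<tau> a \<in> C}))) \<le> int k"
    if v: "v \<in> V" for v
  proof -
    let ?K = "components_minus V E v"
    have finK: "finite ?K" using T by (auto simp: is_tree_def intro: finite_components_minus)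
    \<comment> \<open>Components are disjoint, so at most one part contains \<open>e\<close>; if
      none does, the bound is the nonnegativity of \<open>?d\<close>, which is
      \<open>le\<close>.\<close>
    have one: "(\<Sum>C \<in> ?K. if e \<in> ?B C then ?d else 0) \<le> ?d"
    proof (cases "\<exists>D \<in> ?K. e \<in> ?B D")
      case True
      then obtain D where D: "D \<in> ?K" "e \<in> ?B D" by blast
      have "(\<Sum>C \<in> ?K. if e \<in> ?B C then ?d else 0) = (\<Sum>C \<in> ?K. if C = D then ?d else 0)"
      proof (rule sum.cong)
        fix C assume "C \<in> ?K"
        then have "e \<in> ?B C \<longleftrightarrow> C = D"
          using D components_minus_disjoint[of C V E v D] by blast
        then show "(if e \<in> ?B C then ?d else 0) = (if C = D then ?d else 0)" by simp
      qed simp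
      then show ?thesis using D finK by simp
    next
      case False
      then have "(\<Sum>C \<in> ?K. if e \<in> ?B C then ?d else 0) = 0" by (intro sum.neutral) auto
      then show ?thesis using le by simp
    qed
    have "A - {e} - {a \<in> A - {e}. \<tau> a \<in> C} = A - {e} - ?B C" for C by auto
    then have "(\<Sum>C \<in> ?K. int (r A) - int (r (A - ?B C)) - (if e \<in> ?B C then ?d else 0))
      \<le> (\<Sum>C \<in> ?K. int (s (A - {e})) - int (s (A - {e} - {a \<in> A - {e}. \<tau> a \<in> C})))"
      by (intro sum_mono) (simp only:, intro defect, blast)
    then show ?thesis using one w[OF v] unfolding sum_subtractf by linarith
  qed
  moreover have "\<tau> ` (A - {e}) \<subseteq> V" using T by auto
  ultimately show ?thesis using T(1) unfolding tree_width_at_most_def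
    by (intro exI[of _ V] exI[of _ E] exI[of _ \<tau>] conjI ballI)
qed

text \<open>For \<open>e\<close> in \<open>B\<close> the complement of \<open>B\<close> is
  unaffected. Otherwise, by monotonicity of closure, if deleting \<open>e\<close> lowers the rank of
  \<open>A\<close>, it also lowers that of \<open>A - B\<close>, so the defect does not
  drop.\<close>

lemma (in rank_function) tree_width_at_most_delete:
  assumes "tree_width_at_most k r A" "e \<in> A"
  shows "tree_width_at_most k r (A - {e})"
proof (rule tree_width_at_most_remove[OF assms(1)])
  show "r (A - {e}) \<le> r A" by (rule rank_mono) auto
  fix B assume "B \<subseteq> A"
  have A: "insert e (A - {e}) = A" using assms by auto
  show "int (r A) - int (r (A - B)) - (if e \<in> B then int (r A) - int (r (A - {e})) else 0)
    \<le> int (r (A - {e})) - int (r (A - {e} - B))"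
  proof (cases "e \<in> B")
    case True
    then have "A - {e} - B = A - B" by auto
    then show ?thesis using True by simp
  next
    case False
    then have B: "insert e (A - {e} - B) = A - B" using assms by auto
    have "r (insert e (A - {e} - B)) = r (A - {e} - B) \<Longrightarrow> r (insert e (A - {e})) = r (A - {e})"
      by (rule rank_insert_eq_mono) auto
    then show ?thesis using False rank_insert_le[of e "A - {e}"] rank_insert_le[of e "A - {e} - B"]
      rank_insert_ge[of "A - {e}" e] rank_insert_ge[of "A - {e} - B" e]
      unfolding A B by (cases "r (A - B) = r (A - {e} - B)") auto
  qed
qed

text \<open>The total rank falls by \<open>r {e}\<close>. For \<open>e\<close> outside
  \<open>B\<close> the complement of \<open>B\<close> loses the same amount; for \<open>e\<close>
  inside, adding \<open>e\<close> to that complement raises its rank by at most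
  \<open>r {e}\<close>.\<close>

lemma (in rank_function) tree_width_at_most_contract:
  assumes "tree_width_at_most k r A" "e \<in> A"
  shows "tree_width_at_most k (contract_rank r {e}) (A - {e})"
proof (rule tree_width_at_most_remove[OF assms(1)])
  have A: "insert e (A - {e}) = A" using assms by auto
  then show "contract_rank r {e} (A - {e}) \<le> r A" by (simp add: contract_rank_def)
  fix B assume "B \<subseteq> A"
  have "r {e} \<le> r A" "r {e} \<le> r (insert e (A - {e} - B))" by (rule rank_mono; use assms in auto)+
  moreover have "r (insert e (A - {e} - B)) \<le> r (A - B) + (if e \<in> B then r {e} else 0)"
  proof (cases "e \<in> B")
    case True
    then have "A - {e} - B = A - B" by auto
    then show ?thesis using True rank_submodular[of "{e}" "A - B"] by simp
  next
    case False
    then have "insert e (A - {e} - B) = A - B" using assms by auto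
    then show ?thesis by simp
  qed
  ultimately show "int (r A) - int (r (A - B)) -
      (if e \<in> B then int (r A) - int (contract_rank r {e} (A - {e})) else 0)
    \<le> int (contract_rank r {e} (A - {e})) - int (contract_rank r {e} (A - {e} - B))"
    using A assms(2) by (auto simp: contract_rank_def insert_absorb split: if_splits)
qed

text \<open>Among all components \<open>C\<close> of all \<open>T - v\<close> whose elements have positive rank defect, take a
  smallest one. At the end \<open>u\<close> in \<open>C\<close> of the edge joining \<open>C\<close> to \<open>v\<close>, only the component
  \<open>V - C\<close> contributes to the node width, which is therefore the rank of the elements of \<open>C\<close>.\<close>

lemma (in rank_function) ex_low_rank_nonspanning_complement:
  assumes tw: "tree_width_at_most k r A" and pos: "r A > 0"
  obtains B where "B \<subseteq> A" "r (A - B) < r A" "r B \<le> k"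
proof -
  obtain V :: "nat set" and E \<tau> where T: "is_tree V E" "\<tau> ` A \<subseteq> V"
    and width: "\<forall>v \<in> V. int (r A) - (\<Sum>C \<in> components_minus V E v.
        int (r A) - int (r (A - {e \<in> A. \<tau> e \<in> C}))) \<le> int k"
    using tw unfolding tree_width_at_most_def by (elim exE conjE) (rule that)
  note w = bspec[OF width]
  let ?B = "\<lambda>C. {e \<in> A. \<tau> e \<in> C}"
  define P where "P C \<longleftrightarrow> (\<exists>v \<in> V. C \<in> components_minus V E v) \<and> r (A - ?B C) < r A" for C
  have finV: "finite V" and "V \<noteq> {}" using T by (auto simp: is_tree_def)
  have zero: "int (r A) - int (r (A - ?B C)) = 0" if "C \<in> components_minus V E v" "v \<in> V" "\<not> P C" for v C
    using that rank_mono[of "A - ?B C" A] by (auto simp: P_def)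
  show ?thesis
  proof (cases "\<exists>C. P C")
    \<comment> \<open>With all defects zero, every node width is \<open>r A\<close>, and
      \<open>A\<close> itself serves as \<open>B\<close>; its empty complement is not spanning since
      \<open>r A\<close> is positive.\<close>
    case False
    obtain v where v: "v \<in> V" using \<open>V \<noteq> {}\<close> by blast
    have "(\<Sum>C \<in> components_minus V E v. int (r A) - int (r (A - ?B C))) = 0"
      by (intro sum.neutral ballI zero[OF _ v]) (use False in auto)
    then have "r A \<le> k" using w[OF v] by simp
    then show ?thesis using that[of A] pos rank_empty by simp
  next
    case True
    then obtain C where C: "P C" and minC: "\<And>D. P D \<Longrightarrow> card C \<le> card D"
      using ex_has_least_nat[of P _ card] by blast
    then obtain v where v: "v \<in> V" "C \<in> components_minus V E v" by (auto simp: P_def)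
    obtain u where u: "u \<in> C" "V - C \<in> components_minus V E u"
      using complement_component[OF T(1) v] by blast
    note CV = component_subset[OF T(1) v]
    have uV: "u \<in> V" using u CV by blast
    \<comment> \<open>Any other component of \<open>T - u\<close> is disjoint from
      \<open>V - C\<close> and misses \<open>u\<close>, so it is strictly smaller than
      \<open>C\<close> and has defect zero by minimality.\<close>
    have rest: "int (r A) - int (r (A - ?B D)) = 0" if D: "D \<in> components_minus V E u - {V - C}" for D
    proof -
      have "D \<subseteq> V - {u}" using component_subset[OF T(1) uV] D by blast
      moreover have "D \<inter> (V - C) = {}"
        by (rule components_minus_disjoint[of _ V E u]) (use D u in auto)
      ultimately have "D \<subset> C" using u by blast
      moreover have "finite C" using CV finV finite_subset by blast
      ultimately have "card D < card C" by (rule psubset_card_mono[rotated])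
      then have "\<not> P D" using minC by fastforce
      then show ?thesis using zero D uV by blast
    qed
    have "finite (components_minus V E u)" using finV by (rule finite_components_minus)
    then have "(\<Sum>D \<in> components_minus V E u. int (r A) - int (r (A - ?B D)))
        = int (r A) - int (r (A - ?B (V - C)))"
      using u(2) rest by (subst sum.remove[of _ "V - C"]) auto
    moreover have "A - ?B (V - C) = ?B C" using T(2) by auto
    ultimately have "r (?B C) \<le> k" using w[OF uV] by simp
    then show ?thesis using that[of "?B C"] C by (auto simp: P_def)
  qed
qed

section \<open>Small cocircuits and positivity\<close>

lemma (in rank_function) ex_hyperplane_above:
  assumes "finite A" "B \<subseteq> A" "r B < r A"
  obtains H where "B \<subseteq> H" "H \<subseteq> A" "r H < r A" "\<And>e. e \<in> A - H \<Longrightarrow> r (insert e H) = r A"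
proof -
  let ?S = "{H. H \<subseteq> A \<and> r H < r A}"
  have "finite ?S" by (rule finite_subset[of _ "Pow A"]) (use assms in auto)
  then obtain H where H: "H \<in> ?S" "B \<subseteq> H" "\<And>H'. H' \<in> ?S \<Longrightarrow> H \<subseteq> H' \<Longrightarrow> H = H'"
    using finite_has_maximal2[of ?S B] assms by auto
  have "r (insert e H) = r A" if e: "e \<in> A - H" for e
  proof (rule ccontr)
    assume "r (insert e H) \<noteq> r A"
    moreover have "r (insert e H) \<le> r A" by (rule rank_mono) (use H e in auto)
    ultimately have "H = insert e H" by (intro H(3)) (use H e in auto)
    then show False using e by auto
  qed
  then show ?thesis using that H by blast
qed

lemma whitney_sum_pos_of_tree_width:
  fixes x :: real
  assumes "rank_function r" "finite A" "tree_width_at_most k r A" "no_long_line q r A"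
    and "\<forall>a \<in> A. r {a} = 1" and x: "x > real (\<Sum>i<k. q ^ i)"
  shows "whitney_sum r A x > 0"
proof (rule whitney_sum_pos[where K = "\<lambda>r A. rank_function r \<and> finite A \<and>
    tree_width_at_most k r A \<and> no_long_line q r A", OF _ _ _ _ x])
  fix r :: "'a set \<Rightarrow> nat" and A
  assume K: "rank_function r \<and> finite A \<and> tree_width_at_most k r A \<and> no_long_line q r A"
    and ne: "A \<noteq> {}" and simple: "\<forall>a \<in> A. r {a} = 1" "\<forall>a \<in> A. \<forall>b \<in> A. a \<noteq> b \<longrightarrow> r {a, b} = 2"
  then interpret rank_function r by blast
  obtain a where a: "a \<in> A" using ne by blast
  have "r {a} \<le> r A" by (rule rank_mono) (use a in auto)
  then have "r A > 0" using simple a by auto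
  then obtain B where B: "B \<subseteq> A" "r (A - B) < r A" "r B \<le> k"
    using ex_low_rank_nonspanning_complement K by blast
  \<comment> \<open>Extending the complement of \<open>B\<close> to a hyperplane places the
    cocircuit \<open>A - H\<close> inside \<open>B\<close>, where Kung's bound applies with rank at
    most \<open>k\<close>.\<close>
  obtain H where H: "A - B \<subseteq> H" "H \<subseteq> A" "r H < r A" "\<And>e. e \<in> A - H \<Longrightarrow> r (insert e H) = r A"
    using ex_hyperplane_above[of A "A - B"] B K by blast
  have finB: "finite B" using B K finite_subset by blast
  have "card (A - H) \<le> card B" by (rule card_mono) (use finB H in auto)
  also have "\<dots> \<le> (\<Sum>i<k. q ^ i)"
  proof (rule card_simple_le[of r])
    show "no_long_line q r B" using K B no_long_line_subset by blast
    show "\<forall>a \<in> B. \<forall>b \<in> B. a \<noteq> b \<longrightarrow> r {a, b} = 2" using simple(2) B(1) by blast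
  qed (use K B finB simple in auto)
  finally have "real (card (A - H)) \<le> real (\<Sum>i<k. q ^ i)" by (rule of_nat_mono)
  then show "\<exists>H \<subseteq> A. r H < r A \<and> (\<forall>e \<in> A - H. r (insert e H) = r A) \<and>
      real (card (A - H)) \<le> real (\<Sum>i<k. q ^ i)"
    using H by blast
next
  fix r :: "'a set \<Rightarrow> nat" and A e
  assume K: "rank_function r \<and> finite A \<and> tree_width_at_most k r A \<and> no_long_line q r A"
    and e: "e \<in> A"
  then interpret rank_function r by blast
  show "rank_function r \<and> finite (A - {e}) \<and> tree_width_at_most k r (A - {e}) \<and>
      no_long_line q r (A - {e})"
    using K e tree_width_at_most_delete no_long_line_subset by blast
  show "rank_function (contract_rank r {e}) \<and> finite (A - {e}) \<and>
      tree_width_at_most k (contract_rank r {e}) (A - {e}) \<and>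
      no_long_line q (contract_rank r {e}) (A - {e})"
    using K e tree_width_at_most_contract no_long_line_contract rank_function_contract by blast
qed (use assms in blast)+


section \<open>The rank function of a matroid\<close>

context matroid
begin

lemma card_le_rk: "I \<in> indeps M \<Longrightarrow> I \<subseteq> X \<Longrightarrow> card I \<le> rk M X"
  unfolding rk_def using finite_indeps by (intro Max_ge) auto

lemma finite_indep: "I \<in> indeps M \<Longrightarrow> finite I"
  using indeps_subset finite_ground finite_subset by blast

lemma ex_basis: "\<exists>I \<in> indeps M. I \<subseteq> X \<and> card I = rk M X"
proof -
  have "rk M X \<in> card ` {I \<in> indeps M. I \<subseteq> X}"
    unfolding rk_def using finite_indeps empty_indep by (intro Max_in) auto
  then show ?thesis by auto
qed

text \<open>By \<open>augment\<close>, a maximal independent subset of \<open>X\<close> above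
  \<open>I\<close> cannot be smaller than a basis of \<open>X\<close>.\<close>

lemma ex_basis_extending:
  assumes "I \<in> indeps M" "I \<subseteq> X"
  shows "\<exists>J \<in> indeps M. I \<subseteq> J \<and> J \<subseteq> X \<and> card J = rk M X"
proof -
  let ?S = "{J \<in> indeps M. J \<subseteq> X}"
  have "finite ?S" using finite_indeps by simp
  then obtain J where J: "J \<in> ?S" "I \<subseteq> J" and maxJ: "\<forall>J' \<in> ?S. J \<subseteq> J' \<longrightarrow> J = J'"
    using finite_has_maximal2[of ?S I] assms by blast
  obtain K where K: "K \<in> indeps M" "K \<subseteq> X" "card K = rk M X" using ex_basis by blast
  have "card J \<le> rk M X" using J card_le_rk by blast
  moreover have "\<not> card J < card K"
  proof
    assume "card J < card K"
    then obtain e where "e \<in> K - J" "insert e J \<in> indeps M" using augment J K by blast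
    then have "J = insert e J" using maxJ J K(2) by blast
    then show False using \<open>e \<in> K - J\<close> by blast
  qed
  ultimately show ?thesis using J K by auto
qed

lemma rk_indep: "I \<in> indeps M \<Longrightarrow> rk M I = card I"
proof -
  assume I: "I \<in> indeps M"
  obtain J where "J \<in> indeps M" "J \<subseteq> I" "card J = rk M I" using ex_basis by blast
  moreover from this have "card J \<le> card I" using finite_indep[OF I] by (intro card_mono)
  moreover have "card I \<le> rk M I" using I card_le_rk by blast
  ultimately show ?thesis by simp
qed

lemma rank_function_rk: "rank_function (rk M)"
proof
  show "rk M {} = 0" using rk_indep[OF empty_indep] by simp
  show "rk M {e} \<le> 1" for e
  proof -
    obtain I where "I \<subseteq> {e}" "card I = rk M {e}" using ex_basis by blast
    then show ?thesis using card_mono[of "{e}" I] by simp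
  qed
  show "rk M X \<le> rk M Y" if "X \<subseteq> Y" for X Y
  proof -
    obtain I where "I \<in> indeps M" "I \<subseteq> X" "card I = rk M X" using ex_basis by blast
    then show ?thesis using card_le_rk[of I Y] that by auto
  qed
  show "rk M (X \<union> Y) + rk M (X \<inter> Y) \<le> rk M X + rk M Y" for X Y
  proof -
    \<comment> \<open>A basis of the intersection is extended to one of the union, whose traces on
      \<open>X\<close> and \<open>Y\<close> are independent and share at least the basis of the
      intersection.\<close>
    obtain I where I: "I \<in> indeps M" "I \<subseteq> X \<inter> Y" "card I = rk M (X \<inter> Y)"
      using ex_basis by blast
    then obtain J where J: "J \<in> indeps M" "I \<subseteq> J" "J \<subseteq> X \<union> Y" "card J = rk M (X \<union> Y)"
      using ex_basis_extending[of I "X \<union> Y"] by blast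
    have finJ: "finite J" using J finite_indep by blast
    have "card (J \<inter> X) \<le> rk M X" "card (J \<inter> Y) \<le> rk M Y"
      using J(1) by (auto intro!: card_le_rk intro: indep_mono)
    moreover have "card (J \<inter> X) + card (J \<inter> Y) = card (J \<inter> X \<union> J \<inter> Y) + card (J \<inter> X \<inter> (J \<inter> Y))"
      using finJ by (intro card_Un_Int) auto
    moreover have "J \<inter> X \<union> J \<inter> Y = J" using J(3) by auto
    moreover have "card I \<le> card (J \<inter> X \<inter> (J \<inter> Y))"
      by (rule card_mono) (use finJ I(2) J(2) in auto)
    ultimately show ?thesis using I(3) J(4) by simp
  qed
qed

end

sublocale matroid \<subseteq> rank_function "rk M"
  by (rule rank_function_rk)


section \<open>Whitney's formula for the characteristic polynomial\<close>

text \<open>Toggling a fixed element \<open>a\<close> pairs subsets of opposite sign.\<close>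

lemma sum_sign_Pow:
  assumes "finite F"
  shows "(\<Sum>X \<in> Pow F. (-1) ^ card X :: int) = (if F = {} then 1 else 0)"
proof (cases "F = {}")
  case False
  then obtain a where "a \<in> F" by blast
  then have F: "F = insert a (F - {a})" by auto
  have "(\<Sum>X \<in> Pow F. (-1) ^ card X :: int) = (\<Sum>X \<in> Pow (F - {a}). (-1) ^ card X) +
      (\<Sum>X \<in> insert a ` Pow (F - {a}). (-1) ^ card X)"
    by (subst F, subst Pow_insert, rule sum.union_disjoint) (use assms in auto)
  also have "(\<Sum>X \<in> insert a ` Pow (F - {a}). (-1) ^ card X :: int) =
      (\<Sum>X \<in> Pow (F - {a}). (-1) ^ card (insert a X))"
    by (subst sum.reindex) (auto simp: inj_on_def)
  also have "\<dots> = (\<Sum>X \<in> Pow (F - {a}). - ((-1) ^ card X))"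
  proof (rule sum.cong)
    fix X assume "X \<in> Pow (F - {a})"
    then have "finite X" "a \<notin> X" using assms finite_subset by auto
    then show "(-1) ^ card (insert a X) = - ((-1) ^ card X :: int)" by simp
  qed simp
  finally show ?thesis using False by (simp add: sum_negf)
qed simp

context matroid
begin

definition closure_in :: "'a set \<Rightarrow> 'a set" where
  "closure_in X = {e \<in> ground M. rk M (insert e X) = rk M X}"

lemma subset_closure_in: "X \<subseteq> ground M \<Longrightarrow> X \<subseteq> closure_in X"
  by (auto simp: closure_in_def insert_absorb)

lemma rk_closure_in:
  assumes "X \<subseteq> ground M"
  shows "rk M (closure_in X) = rk M X"
proof -
  have "rk M (closure_in X \<union> X) = rk M X"
    by (rule rank_union_eq) (auto simp: closure_in_def finite_ground)
  then show ?thesis using subset_closure_in[OF assms] by (simp add: Un_absorb2)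
qed

lemma closure_in_flat:
  assumes "X \<subseteq> ground M"
  shows "closure_in X \<in> flats M"
  unfolding flats_def
proof (intro CollectI conjI ballI)
  show "closure_in X \<subseteq> ground M" by (auto simp: closure_in_def)
  fix e assume e: "e \<in> ground M - closure_in X"
  have "rk M (insert e X) \<noteq> rk M X" using e by (auto simp: closure_in_def)
  moreover have "rk M (insert e X) \<le> rk M (insert e (closure_in X))"
    by (rule rank_mono) (use subset_closure_in[OF assms] in auto)
  ultimately show "rk M (closure_in X) < rk M (insert e (closure_in X))"
    using rk_closure_in[OF assms] rank_insert_ge[of X e] by simp
qed

lemma closure_in_subset_flat_iff:
  assumes "X \<subseteq> ground M" "F \<in> flats M"
  shows "closure_in X \<subseteq> F \<longleftrightarrow> X \<subseteq> F"
proof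
  show "X \<subseteq> F" if "closure_in X \<subseteq> F" using that subset_closure_in[OF assms(1)] by blast
  assume X: "X \<subseteq> F"
  show "closure_in X \<subseteq> F"
  proof
    fix e assume e: "e \<in> closure_in X"
    then have "rk M (insert e F) = rk M F"
      using rank_insert_eq_mono[of e X F] X by (simp add: closure_in_def)
    then show "e \<in> F" using e assms(2) by (force simp: closure_in_def flats_def)
  qed
qed

lemma finite_flats: "finite (flats M)"
  by (rule finite_subset[of _ "Pow (ground M)"]) (auto simp: flats_def finite_ground)

text \<open>Both sides satisfy the recursion that defines the Moebius function, because the subsets of
  a flat are partitioned by their closures.\<close>

lemma moebius_flats:
  assumes "{} \<in> flats M" "F \<in> flats M"
  shows "moebius (flats M) {} F = (\<Sum>X \<in> {X \<in> Pow (ground M). closure_in X = F}. (-1) ^ card X)"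
  using assms(2)
proof (induction "card F" arbitrary: F rule: less_induct)
  case less
  let ?g = "\<lambda>F. \<Sum>X \<in> {X \<in> Pow (ground M). closure_in X = F}. (-1) ^ card X :: int"
  let ?Y = "{Y \<in> flats M. {} \<le> Y \<and> Y < F}"
  have FE: "F \<subseteq> ground M" using less.prems by (auto simp: flats_def)
  have finF: "finite F" using FE finite_ground finite_subset by blast
  have "(\<Sum>Y \<in> insert F ?Y. ?g Y) = (\<Sum>X \<in> (\<Union>Y \<in> insert F ?Y. {X \<in> Pow (ground M). closure_in X = Y}). (-1) ^ card X)"
    by (rule sum.UNION_disjoint[symmetric]) (use finite_flats finite_ground in auto)
  also have "(\<Union>Y \<in> insert F ?Y. {X \<in> Pow (ground M). closure_in X = Y}) = Pow F"
    (is "?U = _")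
  proof
    show "?U \<subseteq> Pow F"
    proof
      fix X assume "X \<in> ?U"
      then have "X \<subseteq> ground M" "closure_in X \<subseteq> F" by auto
      then show "X \<in> Pow F" using closure_in_subset_flat_iff less.prems by simp
    qed
    show "Pow F \<subseteq> ?U"
    proof
      fix X assume "X \<in> Pow F"
      then have X: "X \<subseteq> F" "X \<subseteq> ground M" using FE by auto
      then have "closure_in X \<in> insert F ?Y"
        using closure_in_flat[of X] closure_in_subset_flat_iff[of X F] less.prems by auto
      then show "X \<in> ?U" using X by blast
    qed
  qed
  also have "(\<Sum>X \<in> Pow F. (-1) ^ card X :: int) = (if F = {} then 1 else 0)"
    using finF by (rule sum_sign_Pow)
  also have "(\<Sum>Y \<in> insert F ?Y. ?g Y) = ?g F + (\<Sum>Y \<in> ?Y. ?g Y)"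
    by (rule sum.insert) (use finite_flats in auto)
  finally have g: "?g F = (if F = {} then 1 else 0) - (\<Sum>Y \<in> ?Y. ?g Y)" by simp
  have IH: "(\<Sum>Y \<in> ?Y. ?g Y) = (\<Sum>Y \<in> ?Y. moebius (flats M) {} Y)"
  proof (rule sum.cong)
    fix Y assume "Y \<in> ?Y"
    then have "Y \<in> flats M" "card Y < card F" using finF psubset_card_mono by auto
    then show "?g Y = moebius (flats M) {} Y" using less.hyps by simp
  qed simp
  show ?case
  proof (cases "F = {}")
    case True
    then have "?Y = {}" by auto
    then show ?thesis using g True by (simp add: moebius.simps)
  next
    case False
    then have "moebius (flats M) {} F = - (\<Sum>Y \<in> ?Y. moebius (flats M) {} Y)"
      using finite_flats by (subst moebius.simps) auto
    then show ?thesis using g IH False by simp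
  qed
qed

text \<open>Group the subsets by closure: the rank is constant on each group, and the signs in a
  group add up to the Moebius value. Looplessness makes \<open>{}\<close> a flat, as
  \<open>moebius_flats\<close> requires.\<close>

lemma poly_matroid_charpoly:
  assumes "loopless M"
  shows "poly (matroid_charpoly M) x = whitney_sum (rk M) (ground M) x"
proof -
  have rk1: "rk M {e} = 1" if "e \<in> ground M" for e
    using rk_indep[of "{e}"] assms that by (auto simp: loopless_def is_loop_def)
  have empty: "{} \<in> flats M" using rk1 rank_empty by (auto simp: flats_def)
  let ?E = "ground M"
  have "poly (matroid_charpoly M) x =
      (\<Sum>F \<in> flats M. of_int (moebius (flats M) {} F) * x ^ (rk M ?E - rk M F))"
    using assms by (simp add: matroid_charpoly_def poly_sum poly_monom)
  also have "\<dots> = (\<Sum>F \<in> flats M. \<Sum>X \<in> {X \<in> Pow ?E. closure_in X = F}.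
      (-1) ^ card X * x ^ (rk M ?E - rk M X))"
  proof (rule sum.cong)
    fix F assume "F \<in> flats M"
    then have "of_int (moebius (flats M) {} F) * x ^ (rk M ?E - rk M F) =
        (\<Sum>X \<in> {X \<in> Pow ?E. closure_in X = F}. (-1) ^ card X * x ^ (rk M ?E - rk M F))"
      using moebius_flats[OF empty] by (simp add: sum_distrib_right)
    also have "\<dots> = (\<Sum>X \<in> {X \<in> Pow ?E. closure_in X = F}. (-1) ^ card X * x ^ (rk M ?E - rk M X))"
      by (rule sum.cong) (auto simp: rk_closure_in)
    finally show "of_int (moebius (flats M) {} F) * x ^ (rk M ?E - rk M F) = \<dots>" .
  qed simp
  also have "\<dots> = (\<Sum>X \<in> Pow ?E. (-1) ^ card X * x ^ (rk M ?E - rk M X))"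
    by (rule sum.group) (use finite_flats finite_ground closure_in_flat in auto)
  finally show ?thesis by (simp add: whitney_sum_def)
qed

section \<open>The excluded minor and the tree-width in terms of the rank function\<close>

lemma no_long_line_rk:
  assumes "\<not> (\<exists>N. is_minor N M \<and> matroid_iso N (uniform_matroid 2 (2 + q)))"
  shows "no_long_line q (rk M) (ground M)"
  unfolding no_long_line_def
proof (intro allI impI notI, elim conjE)
  fix C S
  assume C: "C \<subseteq> ground M" and S: "S \<subseteq> ground M - C" "card S = q + 2"
    and pairs: "\<forall>a \<in> S. \<forall>b \<in> S. a \<noteq> b \<longrightarrow> contract_rank (rk M) C {a, b} = 2"
    and line: "contract_rank (rk M) C S = 2"
  \<comment> \<open>Contract \<open>C\<close> and keep only \<open>S\<close>: sets of size at most 2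
    are independent because pairs are, and larger ones are dependent because \<open>S\<close> has
    rank 2.\<close>
  let ?N = "delete (contract M C) (ground M - C - S)"
  have gN: "ground ?N = S" using S by (auto simp: delete_def contract_def)
  have iN: "I \<in> indeps ?N \<longleftrightarrow> rk M (I \<union> C) = card I + rk M C" if "I \<subseteq> S" for I
    using that S by (auto simp: delete_def contract_def)
  have finS: "finite S" using S finite_ground finite_subset by blast
  have indep: "I \<in> indeps ?N \<longleftrightarrow> card I \<le> 2" if I: "I \<subseteq> S" for I
  proof
    assume "I \<in> indeps ?N"
    moreover have "rk M (I \<union> C) \<le> rk M (S \<union> C)" by (rule rank_mono) (use I in auto)
    ultimately show "card I \<le> 2" using iN[OF I] line by (simp add: contract_rank_def)
  next
    assume c: "card I \<le> 2"
    \<comment> \<open>\<open>S\<close> has at least two elements, so \<open>I\<close> can be padded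
      to a pair; removing the padding from this independent pair lowers the rank by at most the size
      of the padding.\<close>
    obtain P where P: "I \<subseteq> P" "P \<subseteq> S" "card P = 2"
      using exists_subset_between[of I 2 S] c S I finS by auto
    then obtain a b where ab: "P = {a, b}" "a \<noteq> b" by (auto simp: card_2_iff)
    have finP: "finite P" and finI: "finite I" using ab P(1) finite_subset[of I P] by auto
    have "contract_rank (rk M) C P = 2" using pairs P(2) ab by simp
    then have "rk M (P \<union> C) = 2 + rk M C" unfolding contract_rank_def by linarith
    moreover have "rk M ((P - I) \<union> (I \<union> C)) \<le> card (P - I) + rk M (I \<union> C)"
      by (rule rank_union_le) (use finP in simp)
    moreover have "(P - I) \<union> (I \<union> C) = P \<union> C" using P by auto
    moreover have "card (P - I) + card I = 2"
      using card_Diff_subset[OF finI P(1)] card_mono[OF finP P(1)] P(3) by simp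
    moreover have "rk M (I \<union> C) \<le> card I + rk M C"
      using finI by (rule rank_union_le)
    ultimately have "rk M (I \<union> C) = card I + rk M C" by simp
    then show "I \<in> indeps ?N" using iN[OF I] by simp
  qed
  obtain f where f: "bij_betw f S {..<2 + q}"
    using finite_same_card_bij[of S "{..<2 + q}"] finS S by auto
  have "matroid_iso ?N (uniform_matroid 2 (2 + q))"
    unfolding matroid_iso_def gN
  proof (intro exI[of _ f] conjI allI impI)
    show "bij_betw f S (ground (uniform_matroid 2 (2 + q)))" using f by (simp add: uniform_matroid_def)
    fix I assume I: "I \<subseteq> S"
    have "inj_on f S" "f ` S = {..<2 + q}" using f by (auto simp: bij_betw_def)
    then have "inj_on f I" "f ` I \<subseteq> {..<2 + q}" using I by (blast intro: inj_on_subset)+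
    then show "I \<in> indeps ?N \<longleftrightarrow> f ` I \<in> indeps (uniform_matroid 2 (2 + q))"
      using indep[OF I] by (simp add: uniform_matroid_def card_image)
  qed
  moreover have "is_minor ?N M"
    unfolding is_minor_def by (intro exI[of _ C] exI[of _ "ground M - C - S"]) (use C in auto)
  ultimately show False using assms by blast
qed

lemma tree_width_at_most_rk:
  assumes "tree_width M \<le> int k"
  shows "tree_width_at_most k (rk M) (ground M)"
proof -
  obtain V :: "nat set" and E \<tau> where T: "tree_decomposition M V E \<tau>"
    and w: "tree_width M = decomposition_width M V E \<tau>"
    using tree_width_attained by (auto simp: tree_widths_def)
  have "is_tree V E" "\<tau> ` ground M \<subseteq> V" using T by (auto simp: tree_decomposition_def)
  moreover have "\<forall>v \<in> V. node_width M V E \<tau> v \<le> int k"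
  proof
    fix v assume "v \<in> V"
    moreover have "finite V" using T by (auto simp: tree_decomposition_def is_tree_def)
    ultimately have "node_width M V E \<tau> v \<le> decomposition_width M V E \<tau>"
      unfolding decomposition_width_def by (intro Max_ge) auto
    then show "node_width M V E \<tau> v \<le> int k" using w assms by simp
  qed
  ultimately show ?thesis
    unfolding tree_width_at_most_def node_width_def rank_defect_def
    by (intro exI[of _ V] exI[of _ E] exI[of _ \<tau>] conjI)
qed

end

theorem theorem1p4:
  fixes M :: "'a pre_matroid" and q k :: nat
  assumes "q \<ge> 2" and "k > 0"
    and "matroid M"
    and "tree_width M \<le> int k"
    and "\<not> (\<exists>N. is_minor N M \<and> matroid_iso N (uniform_matroid 2 (2 + q)))"
  shows "matroid_charpoly M = 0 \<or>
    (\<forall>x :: real. x > (real q ^ k - 1) / (real q - 1) \<longrightarrow> poly (matroid_charpoly M) x > 0)"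
proof (cases "loopless M")
  case False
  then show ?thesis by (simp add: matroid_charpoly_def)
next
  case True
  interpret matroid M by fact
  have rk1: "\<forall>e \<in> ground M. rk M {e} = 1"
    using rk_indep True by (auto simp: loopless_def is_loop_def)
  \<comment> \<open>Kung's count as a geometric sum; \<open>q \<ge> 2\<close> keeps the denominator
    nonzero.\<close>
  have "real (\<Sum>i<k. q ^ i) = (real q ^ k - 1) / (real q - 1)"
    using geometric_sum[of "real q" k] assms(1) by simp
  then have "poly (matroid_charpoly M) x > 0" if "x > (real q ^ k - 1) / (real q - 1)" for x
    using whitney_sum_pos_of_tree_width[OF rank_function_rk finite_ground
        tree_width_at_most_rk[OF assms(4)] no_long_line_rk[OF assms(5)] rk1, of x]
      that poly_matroid_charpoly[OF True] by simp
  then show ?thesis by blast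
qed

end
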